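(* The minimum number of monochromatic triangles in a line $2$-coloring of the Desargues configuration, taken over all line $2$-colorings, is $0$.
   Context: A configuration is a pair $(\mathcal{P},\mathcal{L})$ with $\mathcal{P}$ a finite set of points and $\mathcal{L}$ a finite set of subsets of $\mathcal{P}$ called lines, such that any two distinct points lie together on at most one line, all points are on the same number of lines, all lines contain the same number of points, and there are at least three points. Three points $p_1,p_2,p_3$ form a triangle if there are lines $l_1,l_2,l_3$ with $p_1,p_2\in l_1$, $p_3\notin l_1$; $p_2,p_3\in l_2$, $p_1\notin l_2$; $p_1,p_3\in l_3$, $p_2\notin l_3$. The lines $l_1,l_2,l_3$ are then uniquely determined by the points. A line $2$-coloring assigns to each line one of the colors red, blue. A triangle is monochromatic if its lines $l_1,l_2,l_3$ all have the same color. The Desargues configuration is the $10_3$ configuration whose points are the $2$-element subsets of $\{1,2,3,4,5\}$ and whose lines correspond to the $3$-element subsets $T$ of $\{1,2,3,4,5\}$, the line of $T$ consisting of the three $2$-element subsets of $T$. *)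

theory Defs
  imports "HOL-Library.FuncSet"
begin

definition configuration :: "'p set \<Rightarrow> 'p set set \<Rightarrow> bool" where
  "configuration P L \<longleftrightarrow>
     finite P \<and> finite L \<and> (\<forall>l\<in>L. l \<subseteq> P) \<and>
     (\<forall>p\<in>P. \<forall>q\<in>P. p \<noteq> q \<longrightarrow>
        (\<forall>l\<in>L. \<forall>m\<in>L. p \<in> l \<and> q \<in> l \<and> p \<in> m \<and> q \<in> m \<longrightarrow> l = m)) \<and>
     (\<exists>r. \<forall>p\<in>P. card {l \<in> L. p \<in> l} = r) \<and>
     (\<exists>k. \<forall>l\<in>L. card l = k) \<and>
     card P \<ge> 3"

definition triangle_with ::
  "'p set \<Rightarrow> 'p set set \<Rightarrow> 'p \<Rightarrow> 'p \<Rightarrow> 'p \<Rightarrow> 'p set \<Rightarrow> 'p set \<Rightarrow> 'p set \<Rightarrow> bool" where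
  "triangle_with P L p1 p2 p3 l1 l2 l3 \<longleftrightarrow>
     p1 \<in> P \<and> p2 \<in> P \<and> p3 \<in> P \<and> l1 \<in> L \<and> l2 \<in> L \<and> l3 \<in> L \<and>
     p1 \<in> l1 \<and> p2 \<in> l1 \<and> p3 \<notin> l1 \<and>
     p2 \<in> l2 \<and> p3 \<in> l2 \<and> p1 \<notin> l2 \<and>
     p1 \<in> l3 \<and> p3 \<in> l3 \<and> p2 \<notin> l3"

lemma triangle_with_unique_lines:
  assumes "configuration P L"
    and "triangle_with P L p1 p2 p3 l1 l2 l3" and "triangle_with P L p1 p2 p3 m1 m2 m3"
  shows "l1 = m1 \<and> l2 = m2 \<and> l3 = m3"
proof -
  have u: "l = m" if "p \<in> P" "q \<in> P" "p \<noteq> q" "l \<in> L" "m \<in> L"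
    "p \<in> l" "q \<in> l" "p \<in> m" "q \<in> m" for p q l m
    using assms(1) that unfolding configuration_def by blast
  have "p1 \<noteq> p2" "p2 \<noteq> p3" "p1 \<noteq> p3"
    using assms(2) unfolding triangle_with_def by auto
  then show ?thesis
    using assms(2,3) u unfolding triangle_with_def by meson
qed

datatype colour = Red | Blue

text \<open>A line colouring is an extensional function on the set of lines, so that there are only
  finitely many of them.\<close>

definition line_colourings :: "'p set set \<Rightarrow> ('p set \<Rightarrow> colour) set" where
  "line_colourings L = L \<rightarrow>\<^sub>E UNIV"

text \<open>A triangle is identified with its (unordered) set of three vertices. In a configuration the
  three lines are determined by the vertices (\<open>triangle_with_unique_lines\<close>), so the existential
  quantifier over lines introduces no choice.\<close>

definition mono_triangles :: "'p set \<Rightarrow> 'p set set \<Rightarrow> ('p set \<Rightarrow> colour) \<Rightarrow> 'p set set" where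
  "mono_triangles P L c =
     {{p1, p2, p3} | p1 p2 p3.
        \<exists>l1 l2 l3. triangle_with P L p1 p2 p3 l1 l2 l3 \<and> c l1 = c l2 \<and> c l2 = c l3}"

definition min_mono_triangles :: "'p set \<Rightarrow> 'p set set \<Rightarrow> nat" where
  "min_mono_triangles P L = Min ((\<lambda>c. card (mono_triangles P L c)) ` line_colourings L)"

lemma finite_line_colourings:
  assumes "finite L"
  shows "finite (line_colourings L)"
proof -
  have "(UNIV :: colour set) = {Red, Blue}"
    using colour.exhaust by auto
  then have "finite (UNIV :: colour set)"
    by (metis finite.emptyI finite.insertI)
  then show ?thesis
    unfolding line_colourings_def using assms by (intro finite_PiE) auto
qed

lemma line_colourings_nonempty: "line_colourings L \<noteq> {}"
  by (simp add: line_colourings_def PiE_eq_empty_iff)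

lemma finite_mono_triangles:
  assumes "finite P"
  shows "finite (mono_triangles P L c)"
  by (rule finite_subset[of _ "Pow P"])
     (use assms in \<open>auto simp: mono_triangles_def triangle_with_def\<close>)

definition desargues_points :: "nat set set" where
  "desargues_points = {p. p \<subseteq> {1..5} \<and> card p = 2}"

definition desargues_line :: "nat set \<Rightarrow> nat set set" where
  "desargues_line T = {p. p \<subseteq> T \<and> card p = 2}"

definition desargues_lines :: "nat set set set" where
  "desargues_lines = desargues_line ` {T. T \<subseteq> {1..5} \<and> card T = 3}"

lemma card_desargues_points: "card desargues_points = 10"
  unfolding desargues_points_def by (simp add: n_subsets choose_two)

lemma card_desargues_line:
  assumes "card T = 3"
  shows "card (desargues_line T) = 3"
proof -
  have "finite T"
    using assms card.infinite by fastforce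
  then show ?thesis
    unfolding desargues_line_def by (simp add: n_subsets assms choose_two)
qed

lemma Union_desargues_line:
  assumes "card T = 3"
  shows "\<Union> (desargues_line T) = T"
proof -
  obtain a b c where "T = {a, b, c}" "a \<noteq> b" "b \<noteq> c" "a \<noteq> c"
    using assms by (auto simp: card_3_iff)
  then have "{a, b} \<in> desargues_line T" "{a, c} \<in> desargues_line T"
    by (auto simp: desargues_line_def)
  then have "T \<subseteq> \<Union> (desargues_line T)"
    using \<open>T = {a, b, c}\<close> by blast
  then show ?thesis
    by (auto simp: desargues_line_def)
qed

lemma inj_on_desargues_line: "inj_on desargues_line {T. T \<subseteq> {1..5} \<and> card T = 3}"
  by (rule inj_onI) (metis (mono_tags, lifting) Union_desargues_line mem_Collect_eq)

lemma card_desargues_lines: "card desargues_lines = 10"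
proof -
  have "(5::nat) choose 3 = 10"
    by (simp add: eval_nat_numeral)
  then show ?thesis
    unfolding desargues_lines_def card_image[OF inj_on_desargues_line]
    by (simp add: n_subsets)
qed

lemma card_desargues_lines_through:
  assumes "p \<in> desargues_points"
  shows "card {l \<in> desargues_lines. p \<in> l} = 3"
proof -
  have p: "p \<subseteq> {1..5}" "card p = 2" and fp: "finite p"
    using assms finite_subset by (auto simp: desargues_points_def)
  let ?S = "{T. T \<subseteq> {1..5} \<and> card T = 3 \<and> p \<subseteq> T}"
  have "{l \<in> desargues_lines. p \<in> l} = desargues_line ` ?S"
    using p by (auto simp: desargues_lines_def desargues_line_def)
  moreover have "inj_on desargues_line ?S"
    by (rule inj_on_subset[OF inj_on_desargues_line]) auto
  moreover have "?S = (\<lambda>x. insert x p) ` ({1..5} - p)"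
  proof (intro equalityI subsetI)
    fix T assume T: "T \<in> ?S"
    then have "card (T - p) = 1"
      using p fp by (simp add: card_Diff_subset)
    then obtain x where "T - p = {x}"
      by (auto simp: card_1_singleton_iff)
    then have "T = insert x p" "x \<in> {1..5} - p"
      using T by auto
    then show "T \<in> (\<lambda>x. insert x p) ` ({1..5} - p)"
      by blast
  next
    fix T assume "T \<in> (\<lambda>x. insert x p) ` ({1..5} - p)"
    then show "T \<in> ?S"
      using p fp by auto
  qed
  moreover have "inj_on (\<lambda>x. insert x p) ({1..5} - p)"
    by (rule inj_onI) blast
  moreover have "card ({1..5} - p) = 3"
    using p fp by (simp add: card_Diff_subset)
  ultimately show ?thesis
    by (simp add: card_image)
qed

lemma configuration_desargues: "configuration desargues_points desargues_lines"
  unfolding configuration_def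
proof (intro conjI)
  show "finite desargues_points" "finite desargues_lines"
    using card_desargues_points card_desargues_lines card_ge_0_finite by force+
  show "\<forall>l\<in>desargues_lines. l \<subseteq> desargues_points"
    by (auto simp: desargues_lines_def desargues_line_def desargues_points_def)
  show "\<exists>r. \<forall>p\<in>desargues_points. card {l \<in> desargues_lines. p \<in> l} = r"
    using card_desargues_lines_through by blast
  show "\<exists>k. \<forall>l\<in>desargues_lines. card l = k"
    by (rule exI[of _ 3]) (auto simp: desargues_lines_def card_desargues_line)
  show "3 \<le> card desargues_points"
    by (simp add: card_desargues_points)
  have eq: "T = p \<union> q"
    if "p \<noteq> q" "card p = 2" "card q = 2" "p \<subseteq> T" "q \<subseteq> T" "card T = 3" for p q T :: "nat set"
  proof -
    have fT: "finite T"
      using that(6) card.infinite by fastforce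
    then have "p \<subset> p \<union> q"
      using that by (metis card_subset_eq finite_subset sup_ge1 sup_ge2 psubsetI)
    then have "card p < card (p \<union> q)"
      using fT that by (meson finite_UnI finite_subset psubset_card_mono)
    then show ?thesis
      using that fT by (metis Suc_leI Un_least card_seteq eval_nat_numeral(3) numeral_2_eq_2)
  qed
  show "\<forall>p\<in>desargues_points. \<forall>q\<in>desargues_points. p \<noteq> q \<longrightarrow>
        (\<forall>l\<in>desargues_lines. \<forall>m\<in>desargues_lines.
           p \<in> l \<and> q \<in> l \<and> p \<in> m \<and> q \<in> m \<longrightarrow> l = m)"
  proof (intro ballI impI)
    fix p q l m
    assume "p \<noteq> q" "l \<in> desargues_lines" "m \<in> desargues_lines"
      and m: "p \<in> l \<and> q \<in> l \<and> p \<in> m \<and> q \<in> m"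
    then obtain T U where "l = desargues_line T" "m = desargues_line U" "card T = 3" "card U = 3"
      by (auto simp: desargues_lines_def)
    then show "l = m"
      using eq[of p q T] eq[of p q U] \<open>p \<noteq> q\<close> m by (simp add: desargues_line_def)
  qed
qed

end

theory Submission
  imports Defs
begin

text \<open>Identify the line of \<open>T\<close> with the edge \<open>{1..5} - T\<close> of the complete graph on
  \<open>{1..5}\<close>. Two lines meet iff their edges share a vertex, and three lines form a triangle iff
  their edges form a star with three leaves (three edges of a 3-cycle give concurrent lines). Colour
  the edges of a pentagon red and those of the complementary pentagon blue: every vertex then has two
  incident edges of each colour, so no star with three leaves is monochromatic.\<close>

definition pentagon :: "nat set set" where
  "pentagon = {{1, 2}, {2, 3}, {3, 4}, {4, 5}, {5, 1}}"

text \<open>By \<open>Union_desargues_line\<close>, \<open>\<Union> l\<close> recovers the 3-subset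
  behind a line, so the test inspects the complementary edge. Restriction to
  \<open>desargues_lines\<close> makes the function extensional, as \<open>line_colourings\<close>
  demands.\<close>

definition pentagon_colouring :: "nat set set \<Rightarrow> colour" where
  "pentagon_colouring =
     (\<lambda>l\<in>desargues_lines. if {1..5} - \<Union> l \<in> pentagon then Red else Blue)"

lemma pentagon_colouring_eq_Red_iff:
  assumes "card T = 3" "desargues_line T \<in> desargues_lines"
  shows "pentagon_colouring (desargues_line T) = Red \<longleftrightarrow> {1..5} - T \<in> pentagon"
  using assms(2) by (simp add: pentagon_colouring_def Union_desargues_line[OF assms(1)])

text \<open>Of the four other vertices, two are joined to \<open>x\<close> by pentagon edges and two
  are not, so neither class has room for three distinct leaves.\<close>

lemma pentagon_no_mono_star:
  assumes "x \<in> {1..5}" "y1 \<in> {1..5} - {x}" "y2 \<in> {1..5} - {x}" "y3 \<in> {1..5} - {x}"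
    and "distinct [y1, y2, y3]"
    and "{x, y1} \<in> pentagon \<longleftrightarrow> {x, y2} \<in> pentagon" "{x, y2} \<in> pentagon \<longleftrightarrow> {x, y3} \<in> pentagon"
  shows False
proof -
  have "\<exists>a b c d. {1..5} - {x} = {a, b, c, d} \<and> {x, a} \<in> pentagon \<and> {x, b} \<in> pentagon
      \<and> {x, c} \<notin> pentagon \<and> {x, d} \<notin> pentagon"
  proof -
    have "x = 1 \<or> x = 2 \<or> x = 3 \<or> x = 4 \<or> x = 5"
      using assms(1) by auto
    \<comment> \<open>Each list starts with the two pentagon neighbours, matching the roles of
      \<open>a\<close>, \<open>b\<close>, \<open>c\<close>, \<open>d\<close>.\<close>
    moreover have "{1..5} - {1} = {2, 5, 3, 4::nat}" "{1..5} - {2} = {1, 3, 4, 5::nat}"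
      "{1..5} - {3} = {2, 4, 1, 5::nat}" "{1..5} - {4} = {3, 5, 1, 2::nat}"
      "{1..5} - {5} = {1, 4, 2, 3::nat}"
      by auto
    moreover have "{1, 2} \<in> pentagon" "{2, 1} \<in> pentagon" "{2, 3} \<in> pentagon" "{3, 2} \<in> pentagon"
      "{3, 4} \<in> pentagon" "{4, 3} \<in> pentagon" "{4, 5} \<in> pentagon" "{5, 4} \<in> pentagon"
      "{5, 1} \<in> pentagon" "{1, 5} \<in> pentagon"
      "{1, 3} \<notin> pentagon" "{3, 1} \<notin> pentagon" "{1, 4} \<notin> pentagon" "{4, 1} \<notin> pentagon"
      "{2, 4} \<notin> pentagon" "{4, 2} \<notin> pentagon" "{2, 5} \<notin> pentagon" "{5, 2} \<notin> pentagon"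
      "{3, 5} \<notin> pentagon" "{5, 3} \<notin> pentagon"
      by (simp_all add: pentagon_def doubleton_eq_iff)
    ultimately show ?thesis
      by metis
  qed
  then obtain a b c d where nbrs: "{1..5} - {x} = {a, b, c, d}"
    and "{x, a} \<in> pentagon" "{x, b} \<in> pentagon" "{x, c} \<notin> pentagon" "{x, d} \<notin> pentagon"
    by blast
  then show False
    using assms(2-4)[unfolded nbrs] assms(5-7) by auto
qed

text \<open>Each \<open>T\<close> is the union of the two vertices on its line, so together the
  three cover only \<open>T1 \<union> p3\<close>. Inside the 3-set \<open>T2\<close> the pairs
  \<open>p2\<close> and \<open>p3\<close> must meet, which leaves at most four elements. The missing
  \<open>x\<close> becomes the centre of the star.\<close>

lemma desargues_triangle_lines_share_missing_point:
  assumes "triangle_with desargues_points desargues_lines p1 p2 p3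
      (desargues_line T1) (desargues_line T2) (desargues_line T3)"
    and T: "\<And>T. T \<in> {T1, T2, T3} \<Longrightarrow> T \<subseteq> {1..5} \<and> card T = 3"
  obtains x where "x \<in> {1..5}" "x \<notin> T1 \<union> T2 \<union> T3"
proof -
  have p: "card p1 = 2" "card p2 = 2" "card p3 = 2"
    and sub: "p1 \<subseteq> T1" "p2 \<subseteq> T1" "p2 \<subseteq> T2" "p3 \<subseteq> T2" "p1 \<subseteq> T3" "p3 \<subseteq> T3"
    and nsub: "\<not> p3 \<subseteq> T1" "\<not> p1 \<subseteq> T2" "\<not> p2 \<subseteq> T3"
    using assms(1) by (auto simp: triangle_with_def desargues_points_def desargues_line_def)
  have fin: "finite T" if "T \<in> {T1, T2, T3}" for T
    using T[OF that] finite_subset by blast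
  have line_eq: "T = p \<union> q"
    if "card p = 2" "p \<subseteq> T" "q \<subseteq> T" "\<not> q \<subseteq> p" "T \<in> {T1, T2, T3}" for p q T
  proof (rule sym, rule card_subset_eq)
    have "finite (p \<union> q)"
      using fin[OF that(5)] that(2,3) finite_subset by auto
    then have "card p < card (p \<union> q)"
      using that(4) by (intro psubset_card_mono) auto
    moreover have "card (p \<union> q) \<le> card T"
      using fin[OF that(5)] that(2,3) by (intro card_mono) auto
    ultimately show "card (p \<union> q) = card T"
      using T[OF that(5)] that(1) by simp
    show "finite T" "p \<union> q \<subseteq> T"
      using fin[OF that(5)] that(2,3) by blast+
  qed
  have "\<not> p2 \<subseteq> p1" "\<not> p3 \<subseteq> p2" "\<not> p3 \<subseteq> p1"
    using sub nsub by blast+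
  then have T12: "T1 = p1 \<union> p2" and T23: "T2 = p2 \<union> p3" and T13: "T3 = p1 \<union> p3"
    by (simp_all add: line_eq p sub)
  have fp: "finite p1" "finite p2" "finite p3"
    using p card.infinite by fastforce+
  \<comment> \<open>Disjoint pairs would give \<open>T2\<close> four elements.\<close>
  have "p2 \<inter> p3 \<noteq> {}"
    using card_Un_disjoint[OF fp(2,3)] p T[of T2] unfolding T23 by force
  then have "card (T1 \<inter> p3) > 0"
    using fp T12 by (auto simp: card_gt_0_iff)
  moreover have "card T1 + card p3 = card (T1 \<union> p3) + card (T1 \<inter> p3)"
    using fp T12 by (intro card_Un_Int) auto
  \<comment> \<open>The bound is 3 + 2 - 1 = 4 < 5.\<close>
  ultimately have "card (T1 \<union> p3) < card {1..5::nat}"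
    using p T[of T1] by simp
  moreover have "finite (T1 \<union> p3)"
    using fp T12 by simp
  ultimately have "\<not> {1..5} \<subseteq> T1 \<union> p3"
    by (meson card_mono leD)
  then obtain x where "x \<in> {1..5}" "x \<notin> T1 \<union> p3"
    by blast
  moreover have "T1 \<union> T2 \<union> T3 = T1 \<union> p3"
    unfolding T12 T23 T13 by blast
  ultimately show thesis
    by (intro that) simp_all
qed

text \<open>Exhibits the edge attached to \<open>T\<close> as one with endpoint \<open>x\<close>;
  \<open>y\<close> is the corresponding leaf of the star.\<close>

lemma complement_3_subset:
  assumes "T \<subseteq> {1..5::nat}" "card T = 3" "x \<in> {1..5}" "x \<notin> T"
  obtains y where "y \<in> {1..5} - {x}" "{1..5} - T = {x, y}"
proof -
  have "card ({1..5} - T) = 2"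
    using assms(1,2) by (simp add: card_Diff_subset finite_subset)
  moreover have "x \<in> {1..5} - T"
    using assms(3,4) by blast
  ultimately obtain y where "{1..5} - T = {x, y}" "y \<noteq> x"
    by (metis card_2_iff doubleton_eq_iff insertE singletonD)
  then show thesis
    using that by blast
qed

text \<open>A monochromatic triangle would produce a star with leaves \<open>y1\<close>,
  \<open>y2\<close>, \<open>y3\<close> forbidden by \<open>pentagon_no_mono_star\<close>.\<close>

lemma mono_triangles_pentagon_colouring:
  "mono_triangles desargues_points desargues_lines pentagon_colouring = {}"
proof -
  have False
    if tri: "triangle_with desargues_points desargues_lines p1 p2 p3 l1 l2 l3"
      and mono: "pentagon_colouring l1 = pentagon_colouring l2"
        "pentagon_colouring l2 = pentagon_colouring l3" for p1 p2 p3 l1 l2 l3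
  proof -
    have lines: "l1 \<in> desargues_lines" "l2 \<in> desargues_lines" "l3 \<in> desargues_lines"
      \<comment> \<open>Any two of the lines are separated by a vertex lying on just one of
        them.\<close>
      and distinct: "l1 \<noteq> l2" "l2 \<noteq> l3" "l1 \<noteq> l3"
      using tri by (auto simp: triangle_with_def)
    obtain T1 where T1: "T1 \<subseteq> {1..5}" "card T1 = 3" "l1 = desargues_line T1"
      using lines(1) by (auto simp: desargues_lines_def)
    obtain T2 where T2: "T2 \<subseteq> {1..5}" "card T2 = 3" "l2 = desargues_line T2"
      using lines(2) by (auto simp: desargues_lines_def)
    obtain T3 where T3: "T3 \<subseteq> {1..5}" "card T3 = 3" "l3 = desargues_line T3"
      using lines(3) by (auto simp: desargues_lines_def)
    obtain x where x: "x \<in> {1..5}" "x \<notin> T1 \<union> T2 \<union> T3"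
    proof (rule desargues_triangle_lines_share_missing_point)
      show "triangle_with desargues_points desargues_lines p1 p2 p3
          (desargues_line T1) (desargues_line T2) (desargues_line T3)"
        using tri T1(3) T2(3) T3(3) by simp
    qed (use T1 T2 T3 in auto)
    obtain y1 where y1: "y1 \<in> {1..5} - {x}" "{1..5} - T1 = {x, y1}"
      using complement_3_subset[OF T1(1,2) x(1)] x(2) by blast
    obtain y2 where y2: "y2 \<in> {1..5} - {x}" "{1..5} - T2 = {x, y2}"
      using complement_3_subset[OF T2(1,2) x(1)] x(2) by blast
    obtain y3 where y3: "y3 \<in> {1..5} - {x}" "{1..5} - T3 = {x, y3}"
      using complement_3_subset[OF T3(1,2) x(1)] x(2) by blast
    \<comment> \<open>A leaf determines its \<open>T\<close> by complementation, so equal leaves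
      would force equal lines.\<close>
    have "distinct [y1, y2, y3]"
    proof -
      have "T1 = {1..5} - {x, y1}" "T2 = {1..5} - {x, y2}" "T3 = {1..5} - {x, y3}"
        using T1(1) T2(1) T3(1) y1(2) y2(2) y3(2) by blast+
      then show ?thesis
        using distinct T1(3) T2(3) T3(3) by auto
    qed
    moreover have "pentagon_colouring l1 = Red \<longleftrightarrow> {x, y1} \<in> pentagon"
      "pentagon_colouring l2 = Red \<longleftrightarrow> {x, y2} \<in> pentagon"
      "pentagon_colouring l3 = Red \<longleftrightarrow> {x, y3} \<in> pentagon"
      using lines pentagon_colouring_eq_Red_iff[OF T1(2)] pentagon_colouring_eq_Red_iff[OF T2(2)]
        pentagon_colouring_eq_Red_iff[OF T3(2)]
      unfolding T1(3) T2(3) T3(3) y1(2) y2(2) y3(2) by blast+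
    then have "{x, y1} \<in> pentagon \<longleftrightarrow> {x, y2} \<in> pentagon"
      "{x, y2} \<in> pentagon \<longleftrightarrow> {x, y3} \<in> pentagon"
      using mono by metis+
    ultimately show False
      by (intro pentagon_no_mono_star[OF x(1) y1(1) y2(1) y3(1)])
  qed
  then show ?thesis
    unfolding mono_triangles_def by blast
qed

theorem theorem4p6:
  shows "min_mono_triangles desargues_points desargues_lines = 0"
proof -
  let ?f = "\<lambda>c. card (mono_triangles desargues_points desargues_lines c)"
  have "finite desargues_lines"
    using configuration_desargues by (simp add: configuration_def)
  then have "finite (?f ` line_colourings desargues_lines)"
    by (simp add: finite_line_colourings)
  moreover have "pentagon_colouring \<in> line_colourings desargues_lines"
    by (simp add: pentagon_colouring_def line_colourings_def)
  then have "?f pentagon_colouring \<in> ?f ` line_colourings desargues_lines"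
    by (rule imageI)
  \<comment> \<open>The right-hand side is 0, and no natural number lies below it, so this upper
    bound fixes the minimum.\<close>
  ultimately have "Min (?f ` line_colourings desargues_lines) \<le> ?f pentagon_colouring"
    by (rule Min_le)
  then show ?thesis
    by (simp add: min_mono_triangles_def mono_triangles_pentagon_colouring)
qed

end
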